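(* Let $G$ and $H$ be two graphs of orders $n$ and $m$, respectively, such that $\delta(G)\leq\delta(H)$. If $\min\{\delta(G)+m,\ \delta(H)+n\}\geq\frac{n+m-1}{2}$ and $m+n\geq 7$, then $D'(G+H)\leq 2$.
   Context: $\delta(X)$ denotes the minimum degree of a graph $X$. The join $G+H$ of graphs on disjoint vertex sets has as edges all edges of $G$, all edges of $H$, and all pairs with one end in $V(G)$ and the other in $V(H)$. The distinguishing index $D'(X)$ is the least $d$ such that $X$ has an edge colouring with $d$ colours preserved by no non-identity automorphism of $X$. *)

theory Defs
  imports Complex_Main "HOL-Combinatorics.Permutations" "HOL-Library.Extended_Nat"
begin

record 'a ugraph =
  verts :: "'a set"
  edges :: "'a set set"

text \<open>
  Finite simple graphs. The null graph is excluded, as usual; its minimum degree would be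
  undefined.
\<close>

definition simple_graph :: "'a ugraph \<Rightarrow> bool" where
  "simple_graph X \<longleftrightarrow> finite (verts X) \<and> verts X \<noteq> {} \<and>
     (\<forall>e \<in> edges X. e \<subseteq> verts X \<and> card e = 2)"

definition degree :: "'a ugraph \<Rightarrow> 'a \<Rightarrow> nat" where
  "degree X v = card {e \<in> edges X. v \<in> e}"

definition min_degree :: "'a ugraph \<Rightarrow> nat" where
  "min_degree X = Min (degree X ` verts X)"

text \<open>To be used only for graphs whose vertex sets are disjoint.\<close>

definition join :: "'a ugraph \<Rightarrow> 'a ugraph \<Rightarrow> 'a ugraph" where
  "join G H = \<lparr> verts = verts G \<union> verts H,
                edges = edges G \<union> edges H \<union> {{u, v} | u v. u \<in> verts G \<and> v \<in> verts H} \<rparr>"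

text \<open>
  Using \<open>permutes\<close>, automorphisms fix everything outside the vertex set, so the identity
  automorphism is exactly the function \<^term>\<open>id\<close>.
\<close>

definition automorphism :: "'a ugraph \<Rightarrow> ('a \<Rightarrow> 'a) \<Rightarrow> bool" where
  "automorphism X f \<longleftrightarrow> f permutes verts X \<and>
     (\<forall>u \<in> verts X. \<forall>v \<in> verts X. {f u, f v} \<in> edges X \<longleftrightarrow> {u, v} \<in> edges X)"

text \<open>
  The colours are \<open>0, \<dots>, d - 1\<close>; not all of them need occur, and adjacent edges may share a colour.
\<close>

definition edge_colouring :: "'a ugraph \<Rightarrow> nat \<Rightarrow> ('a set \<Rightarrow> nat) \<Rightarrow> bool" where
  "edge_colouring X d c \<longleftrightarrow> (\<forall>e \<in> edges X. c e < d)"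

definition preserves_colouring :: "'a ugraph \<Rightarrow> ('a set \<Rightarrow> nat) \<Rightarrow> ('a \<Rightarrow> 'a) \<Rightarrow> bool" where
  "preserves_colouring X c f \<longleftrightarrow> (\<forall>e \<in> edges X. c (f ` e) = c e)"

definition distinguishing :: "'a ugraph \<Rightarrow> ('a set \<Rightarrow> nat) \<Rightarrow> bool" where
  "distinguishing X c \<longleftrightarrow>
     \<not> (\<exists>f. automorphism X f \<and> f \<noteq> id \<and> preserves_colouring X c f)"

text \<open>
  Graphs such as \<open>K\<^sub>2\<close> have no distinguishing edge colouring at all; their index is \<open>\<infinity>\<close>
  (the infimum of the empty set), so a finite upper bound entails that a colouring exists.
\<close>

definition distinguishing_index :: "'a ugraph \<Rightarrow> enat" where
  "distinguishing_index X =
     Inf (enat ` {d. \<exists>c. edge_colouring X d c \<and> distinguishing X c})"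

end

theory Submission imports Defs "HOL-Library.Sublist" begin

text \<open>
  Colour the edges of a spanning subgraph \<open>T\<close> with one colour and the remaining edges with the
  other: if \<open>T\<close> is asymmetric, the colouring is distinguishing. We take for \<open>T\<close> a spider, that is,
  three paths of distinct positive lengths issuing from a common centre. Since the join has minimum
  degree at least \<open>(N - 1) / 2\<close>, where \<open>N = n + m\<close>, it has a Hamiltonian path \<open>v\<^sub>1 \<dots> v\<^sub>N\<close> by Dirac's
  argument. A chord \<open>v\<^sub>1 v\<^sub>i\<close> yields a spider with centre \<open>v\<^sub>i\<close> and legs of lengths \<open>1\<close>, \<open>i - 2\<close> and
  \<open>N - i\<close>, so only \<open>i = 2, 3, N - 1, N, (N + 2) / 2\<close> are useless. If the path closes to a cycle, then
  \<open>i = 3\<close> and \<open>i = N - 1\<close> are useful too, and the degree of \<open>v\<^sub>1\<close> forces a useful chord. Otherwise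
  the degrees of the ends force the edges \<open>v\<^sub>1 v\<^sub>3\<close> and \<open>v\<^sub>N v\<^sub>2\<close>, unless there is a useful chord, and
  \<open>v\<^sub>1 v\<^sub>3 v\<^sub>4 \<dots> v\<^sub>N v\<^sub>2\<close> is a Hamiltonian cycle.
\<close>

section \<open>Edge sets of paths given as vertex lists\<close>

fun path_edges :: "'a list \<Rightarrow> 'a set set" where
  "path_edges (x # y # zs) = insert {x, y} (path_edges (y # zs))"
| "path_edges _ = {}"

lemma path_edges_Cons:
  "path_edges (x # xs) = (if xs = [] then {} else insert {x, hd xs} (path_edges xs))"
  by (cases xs) auto

lemma path_edges_append:
  "path_edges (xs @ ys) = path_edges xs \<union> path_edges ys \<union>
     (if xs = [] \<or> ys = [] then {} else {{last xs, hd ys}})"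
  by (induction xs) (auto simp: path_edges_Cons)

lemma path_edges_rev: "path_edges (rev xs) = path_edges xs"
  by (induction xs) (auto simp: path_edges_Cons path_edges_append last_rev insert_commute)

lemma path_edges_iff: "e \<in> path_edges xs \<longleftrightarrow> (\<exists>i. Suc i < length xs \<and> e = {xs ! i, xs ! Suc i})"
proof (induction xs)
  case (Cons x xs)
  have "(\<exists>i. Suc i < length (x # xs) \<and> e = {(x # xs) ! i, (x # xs) ! Suc i}) \<longleftrightarrow>
     (xs \<noteq> [] \<and> e = {x, xs ! 0}) \<or> (\<exists>i. Suc i < length xs \<and> e = {xs ! i, xs ! Suc i})"
    (is "(\<exists>i. ?P i) \<longleftrightarrow> ?R")
  proof
    assume "\<exists>i. ?P i"
    then obtain i where "?P i" ..
    then show ?R by (cases i) auto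
  next
    assume ?R
    then show "\<exists>i. ?P i"
    proof
      assume "xs \<noteq> [] \<and> e = {x, xs ! 0}"
      then show ?thesis by (intro exI[of _ 0]) auto
    next
      assume "\<exists>i. Suc i < length xs \<and> e = {xs ! i, xs ! Suc i}"
      then obtain i where "Suc i < length xs \<and> e = {xs ! i, xs ! Suc i}" ..
      then show ?thesis by (intro exI[of _ "Suc i"]) auto
    qed
  qed
  then show ?case using Cons by (auto simp: path_edges_Cons hd_conv_nth)
qed auto

text \<open>Distinctness makes positions unique, so a vertex of the path is joined only to its
  predecessor and its successor.\<close>

lemma path_edges_nth:
  assumes "distinct xs" "i < length xs" "{xs ! i, z} \<in> path_edges xs"
  shows "(Suc i < length xs \<and> z = xs ! Suc i) \<or> (i > 0 \<and> z = xs ! (i - 1))"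
proof -
  obtain j where j: "Suc j < length xs" "{xs ! i, z} = {xs ! j, xs ! Suc j}"
    using assms(3) by (auto simp: path_edges_iff)
  then have "(xs ! i = xs ! j \<and> z = xs ! Suc j) \<or> (xs ! i = xs ! Suc j \<and> z = xs ! j)"
    by (auto simp: doubleton_eq_iff)
  then show ?thesis
    using assms j nth_eq_iff_index_eq[OF assms(1)] by auto
qed

lemma path_edges_subset: "e \<in> path_edges xs \<Longrightarrow> e \<subseteq> set xs"
  by (auto simp: path_edges_iff)

section \<open>Spiders\<close>

text \<open>Legs are listed outwards and omit the centre, so the inner neighbour of
  \<open>X ! i\<close> is \<open>(c # X) ! i\<close>, also for \<open>i = 0\<close>.\<close>

definition spider :: "'a \<Rightarrow> 'a list \<Rightarrow> 'a list \<Rightarrow> 'a list \<Rightarrow> 'a set set" where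
  "spider c A B C = path_edges (c # A) \<union> path_edges (c # B) \<union> path_edges (c # C)"

lemma spider_commute: "spider c A B C = spider c A C B"
  by (auto simp: spider_def)

lemma spider_centre:
  assumes "distinct (c # A @ B @ C)" "{c, z} \<in> spider c A B C"
  shows "\<exists>X \<in> {A, B, C}. X \<noteq> [] \<and> z = hd X"
proof -
  have *: "X \<noteq> [] \<and> z = hd X" if "distinct (c # X)" "{c, z} \<in> path_edges (c # X)" for X
    using path_edges_nth[OF that(1), of 0 z] that(2) by (auto simp: hd_conv_nth)
  show ?thesis using assms *[of A] *[of B] *[of C] by (auto simp: spider_def)
qed

lemma spider_first_leg:
  assumes "distinct (c # A @ B @ C)" "i < length A" "{A ! i, z} \<in> spider c A B C"
  shows "z = (c # A) ! i \<or> (Suc i < length A \<and> z = A ! Suc i)"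
proof -
  have "A ! i \<in> set A" using assms(2) by simp
  then have "A ! i \<notin> set (c # B)" "A ! i \<notin> set (c # C)" using assms(1) by auto
  then have "{A ! i, z} \<in> path_edges (c # A)"
    using assms(3) path_edges_subset[of "{A ! i, z}"] by (force simp: spider_def)
  then show ?thesis
    using path_edges_nth[of "c # A" "Suc i" z] assms by auto
qed

text \<open>The edge set is symmetric in the three legs, so any leg can be moved to the first
  place.\<close>

lemma spider_leg:
  assumes "distinct (c # A @ B @ C)" "X \<in> {A, B, C}" "i < length X" "{X ! i, z} \<in> spider c A B C"
  shows "z = (c # X) ! i \<or> (Suc i < length X \<and> z = X ! Suc i)"
  using assms(2)
proof (elim insertE emptyE)
  assume "X = A"
  then show ?thesis using spider_first_leg[of c A B C i z] assms by simp
next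
  assume "X = B"
  moreover have "spider c A B C = spider c B A C" by (auto simp: spider_def)
  ultimately show ?thesis using spider_first_leg[of c B A C i z] assms by auto
next
  assume "X = C"
  moreover have "spider c A B C = spider c C A B" by (auto simp: spider_def)
  ultimately show ?thesis using spider_first_leg[of c C A B i z] assms by auto
qed

text \<open>The first step from the centre chooses a leg; from then on the path cannot turn back and
  must follow that leg outwards.\<close>

lemma spider_path_prefix:
  assumes "distinct (c # A @ B @ C)"
    and "distinct (c # L)" "path_edges (c # L) \<subseteq> spider c A B C"
  shows "\<exists>X \<in> {A, B, C}. prefix L X"
  using assms(2,3)
proof (induction L rule: rev_induct)
  case (snoc z L)
  have "path_edges (c # L @ [z]) = path_edges (c # L) \<union> {{last (c # L), z}}"
    using path_edges_append[of "c # L" "[z]"] by simp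
  with snoc obtain X where X: "X \<in> {A, B, C}" "prefix L X"
    and e: "{last (c # L), z} \<in> spider c A B C" by auto
  show ?case
  proof (cases L rule: rev_cases)
    case Nil
    then obtain Y where Y: "Y \<in> {A, B, C}" "Y \<noteq> []" "z = hd Y"
      using spider_centre[OF assms(1)] e by auto
    then have "prefix (L @ [z]) Y" using Nil by (cases Y) auto
    then show ?thesis using Y by blast
  next
    case (snoc L' y)
    obtain S where S: "X = L @ S" using X(2) by (auto simp: prefix_def)
    have i: "length L' < length X" "X ! length L' = y" "last (c # L) = y"
      using snoc S by (auto simp: nth_append)
    \<comment> \<open>The inner neighbour of \<open>y\<close> is the centre or an earlier entry of
      \<open>L\<close>, hence already used; only the outer one remains.\<close>
    have "(c # X) ! length L' \<in> set (c # L)"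
      using snoc S by (auto simp: nth_Cons nth_append split: nat.split)
    then have "z \<noteq> (c # X) ! length L'" using snoc.prems by auto
    then have "Suc (length L') < length X" "z = X ! Suc (length L')"
      using spider_leg[OF assms(1) X(1) i(1)] e i by auto
    then have "prefix (L @ [z]) X"
      using S snoc by (cases S) (auto simp: nth_append)
    then show ?thesis using X(1) by blast
  qed
qed auto

lemma path_edges_map:
  assumes "\<And>u v. {u, v} \<in> R \<Longrightarrow> {f u, f v} \<in> R" "path_edges xs \<subseteq> R"
  shows "path_edges (map f xs) \<subseteq> R"
  using assms(2) by (induction xs) (auto simp: path_edges_Cons hd_map intro: assms(1))

text \<open>The centre is the only vertex with three neighbours, so it is fixed. The image of a leg
  is then a path from the centre, hence a prefix of some leg, and the distinct lengths leave each
  leg only itself.\<close>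

lemma spider_asymmetric:
  assumes d: "distinct (c # A @ B @ C)"
    and len: "0 < length A" "length A < length B" "length B < length C"
    and inj: "inj_on f (set (c # A @ B @ C))" and im: "f c \<in> set (c # A @ B @ C)"
    and hom: "\<And>u v. {u, v} \<in> spider c A B C \<Longrightarrow> {f u, f v} \<in> spider c A B C"
    and x: "x \<in> set (c # A @ B @ C)"
  shows "f x = x"
proof -
  have ne: "A \<noteq> []" "B \<noteq> []" "C \<noteq> []" using len by auto
  have fc: "f c = c"
  proof (rule ccontr)
    assume "f c \<noteq> c"
    then obtain X where X: "X \<in> {A, B, C}" "f c \<in> set X" using im by auto
    then obtain i where i: "i < length X" "f c = X ! i" by (auto simp: in_set_conv_nth)
    have "{c, hd Y} \<in> spider c A B C" if "Y \<in> {A, B, C}" for Y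
      using that ne by (auto simp: spider_def path_edges_Cons)
    \<comment> \<open>The condition \<open>Suc i < length X\<close> may be dropped: two candidate
      values already contradict three distinct images.\<close>
    then have nb: "f (hd Y) = (c # X) ! i \<or> f (hd Y) = X ! Suc i" if "Y \<in> {A, B, C}" for Y
      using spider_leg[OF d X(1) i(1)] hom i(2) that by metis
    have "hd A \<in> set A" "hd B \<in> set B" "hd C \<in> set C" using ne by auto
    then have "hd A \<noteq> hd B" "hd B \<noteq> hd C" "hd A \<noteq> hd C"
      and "{hd A, hd B, hd C} \<subseteq> set (c # A @ B @ C)" using d by auto
    then have "f (hd A) \<noteq> f (hd B)" "f (hd B) \<noteq> f (hd C)" "f (hd A) \<noteq> f (hd C)"
      using inj_onD[OF inj] by (metis insert_subset)+
    then show False using nb[of A] nb[of B] nb[of C] by auto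
  qed
  have pre: "\<exists>X \<in> {A, B, C}. prefix (map f Y) X" if Y: "Y \<in> {A, B, C}" for Y
  proof (rule spider_path_prefix[OF d])
    have "set (c # Y) \<subseteq> set (c # A @ B @ C)" "distinct (c # Y)" using Y d by auto
    then have "distinct (map f (c # Y))"
      using inj_on_subset[OF inj] unfolding distinct_map by blast
    then show "distinct (c # map f Y)" using fc by simp
    have "path_edges (c # Y) \<subseteq> spider c A B C" using Y by (auto simp: spider_def)
    then have "path_edges (map f (c # Y)) \<subseteq> spider c A B C" using path_edges_map[where f = f] hom by blast
    then show "path_edges (c # map f Y) \<subseteq> spider c A B C" using fc by simp
  qed
  have mixed: "\<not> prefix (map f Y) X"
    if "Y \<in> {A, B, C}" "X \<in> {A, B, C}" "map f X = X" "X \<noteq> Y" for X Y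
  proof
    assume p: "prefix (map f Y) X"
    have n: "Y \<noteq> []" "X \<noteq> []" using that ne by auto
    then have "f (hd Y) = hd X"
      using p by (auto simp: prefix_def hd_append hd_map)
    moreover have "f (hd X) = hd X" using that(3) n by (metis hd_map)
    moreover have m: "hd X \<in> set X" "hd Y \<in> set Y" using n by auto
    then have "hd X \<in> set (c # A @ B @ C)" "hd Y \<in> set (c # A @ B @ C)" using that by auto
    ultimately have "hd X = hd Y" using inj_onD[OF inj] by metis
    then show False using m that d by auto
  qed
  have eq: "map f Y = Y" if "prefix (map f Y) Y" for Y
    using that by (auto simp: prefix_def) (metis append.right_neutral append_eq_append_conv length_map)
  have le: "\<not> prefix (map f X) Y" if "length Y < length X" for X Y
    using that prefix_length_le[of "map f X" Y] by auto
  \<comment> \<open>The longest leg fits only into itself. By injectivity no other leg can enter one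
    that is already fixed, and \<open>B\<close> is too long for \<open>A\<close>.\<close>
  have C: "map f C = C" using pre[of C] le len eq by auto
  have B: "map f B = B" using pre[of B] mixed[of B C] C le[of A B] len eq by auto
  have A: "map f A = A" using pre[of A] mixed[of A C] mixed[of A B] B C len eq by auto
  show ?thesis using x fc A B C by (auto simp: map_idI list_eq_iff_nth_eq in_set_conv_nth)
qed

definition spanning_spider :: "'a ugraph \<Rightarrow> 'a \<Rightarrow> 'a list \<Rightarrow> 'a list \<Rightarrow> 'a list \<Rightarrow> bool" where
  "spanning_spider X c A B C \<longleftrightarrow> distinct (c # A @ B @ C) \<and> set (c # A @ B @ C) = verts X \<and>
     spider c A B C \<subseteq> edges X \<and> 0 < length A \<and> length A < length B \<and> length B < length C"

lemma spanning_spider_index: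
  assumes "spanning_spider X c A B C"
  shows "distinguishing_index X \<le> 2"
proof -
  let ?col = "\<lambda>e. if e \<in> spider c A B C then 0 else 1 :: nat"
  have "edge_colouring X 2 ?col" by (auto simp: edge_colouring_def)
  moreover have "distinguishing X ?col"
    unfolding distinguishing_def
  proof clarify
    fix f assume f: "automorphism X f" "preserves_colouring X ?col f" "f \<noteq> id"
    have perm: "f permutes verts X" using f(1) by (simp add: automorphism_def)
    have V: "set (c # A @ B @ C) = verts X" using assms by (auto simp: spanning_spider_def)
    have fx: "f x = x" if "x \<in> set (c # A @ B @ C)" for x
    proof (rule spider_asymmetric[OF _ _ _ _ _ _ _ that])
      show "inj_on f (set (c # A @ B @ C))" using permutes_inj_on[OF perm] .
      have "c \<in> verts X" using V by auto
      then show "f c \<in> set (c # A @ B @ C)" unfolding V using permutes_in_image[OF perm] by simp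
      fix u v assume uv: "{u, v} \<in> spider c A B C"
      then have "{u, v} \<in> edges X" using assms by (auto simp: spanning_spider_def)
      then have "?col (f ` {u, v}) = ?col {u, v}"
        using f(2) unfolding preserves_colouring_def by blast
      then show "{f u, f v} \<in> spider c A B C" using uv by (simp split: if_splits)
    qed (use assms in \<open>auto simp: spanning_spider_def\<close>)
    have "f x = x" for x
      using fx[of x] permutes_not_in[OF perm, of x] unfolding V by blast
    then show False using f(3) by auto
  qed
  ultimately have "enat 2 \<in> enat ` {d. \<exists>c. edge_colouring X d c \<and> distinguishing X c}" by blast
  then have "distinguishing_index X \<le> enat 2" unfolding distinguishing_index_def by (rule Inf_lower)
  then show ?thesis by (simp add: numeral_eq_enat)
qed

section \<open>Hamiltonian paths\<close>

definition nbrs :: "'a ugraph \<Rightarrow> 'a \<Rightarrow> 'a set" where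
  "nbrs X v = {u. {v, u} \<in> edges X}"

lemma nbrs_subset:
  assumes "simple_graph X"
  shows "nbrs X v \<subseteq> verts X - {v}"
proof
  fix u assume "u \<in> nbrs X v"
  then have "{v, u} \<subseteq> verts X" "card {v, u} = 2"
    using assms by (auto simp: nbrs_def simple_graph_def)
  then show "u \<in> verts X - {v}" by (cases "u = v") auto
qed

lemma finite_nbrs: "simple_graph X \<Longrightarrow> finite (nbrs X v)"
  using nbrs_subset[of X v] by (auto simp: simple_graph_def intro: finite_subset)

lemma degree_eq_card_nbrs:
  assumes "simple_graph X"
  shows "degree X v = card (nbrs X v)"
proof -
  have "{e \<in> edges X. v \<in> e} = (\<lambda>u. {v, u}) ` nbrs X v"
  proof (intro equalityI subsetI)
    fix e assume e: "e \<in> {e \<in> edges X. v \<in> e}"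
    then have "card e = 2" using assms by (auto simp: simple_graph_def)
    then obtain a b where "e = {a, b}" by (auto simp: card_2_iff)
    then obtain u where "e = {v, u}" using e by (auto simp: insert_commute)
    then show "e \<in> (\<lambda>u. {v, u}) ` nbrs X v" using e by (auto simp: nbrs_def)
  qed (auto simp: nbrs_def)
  moreover have "inj_on (\<lambda>u. {v, u}) (nbrs X v)"
    by (auto simp: inj_on_def doubleton_eq_iff)
  ultimately show ?thesis by (simp add: degree_def card_image)
qed

text \<open>Turns counts of neighbours into counts of positions on a path, as indexing a distinct
  list is injective.\<close>

lemma card_nth_indices:
  assumes "distinct xs" "S \<subseteq> set xs"
  shows "card {i. i < length xs \<and> xs ! i \<in> S} = card S"
proof -
  have "(!) xs ` {i. i < length xs \<and> xs ! i \<in> S} = S"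
    using assms(2) by (auto simp: in_set_conv_nth image_iff) (metis in_set_conv_nth subsetD)
  moreover have "inj_on ((!) xs) {i. i < length xs \<and> xs ! i \<in> S}"
    using assms(1) by (auto simp: inj_on_def nth_eq_iff_index_eq)
  ultimately show ?thesis by (metis card_image)
qed

definition path_in :: "'a ugraph \<Rightarrow> 'a list \<Rightarrow> bool" where
  "path_in X xs \<longleftrightarrow> distinct xs \<and> set xs \<subseteq> verts X \<and> path_edges xs \<subseteq> edges X"

lemma path_in_rev: "path_in X (rev xs) \<longleftrightarrow> path_in X xs"
  by (simp add: path_in_def path_edges_rev)

text \<open>Dirac's crossing argument: two crossing chords at the ends turn the path into a cycle.\<close>

lemma path_to_cycle:
  assumes "simple_graph X" and path: "path_in X xs" and ne: "xs \<noteq> []"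
    and hd: "nbrs X (hd xs) \<subseteq> set xs" and last: "nbrs X (last xs) \<subseteq> set xs"
    and deg: "length xs \<le> card (nbrs X (hd xs)) + card (nbrs X (last xs))"
  obtains cs where "path_in X cs" "set cs = set xs" "cs \<noteq> []" "last cs \<in> nbrs X (hd cs)"
proof -
  let ?k = "length xs - 1"
  \<comment> \<open>The shift by one in \<open>I\<close> makes a common index of \<open>I\<close>
    and \<open>J\<close> a pair of consecutive vertices, the earlier joined to the last vertex and
    the later to the first.\<close>
  define I where "I = {i. i < ?k \<and> xs ! Suc i \<in> nbrs X (hd xs)}"
  define J where "J = {i. i < ?k \<and> xs ! i \<in> nbrs X (last xs)}"
  have d: "distinct xs" using path by (simp add: path_in_def)
  have t: "tl xs ! i = xs ! Suc i" if "i < ?k" for i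
    using that by (simp add: nth_tl)
  have "nbrs X (hd xs) \<subseteq> set (tl xs)"
    using hd nbrs_subset[OF assms(1), of "hd xs"] ne by (cases xs) auto
  then have "card {i. i < length (tl xs) \<and> tl xs ! i \<in> nbrs X (hd xs)} = card (nbrs X (hd xs))"
    using d by (intro card_nth_indices) (auto simp: distinct_tl)
  moreover have "{i. i < length (tl xs) \<and> tl xs ! i \<in> nbrs X (hd xs)} = I"
    using t by (auto simp: I_def)
  ultimately have cI: "card I = card (nbrs X (hd xs))" by simp
  have "nbrs X (last xs) \<subseteq> set (butlast xs)"
    using last nbrs_subset[OF assms(1), of "last xs"] ne by (cases xs rule: rev_cases) auto
  then have "card {i. i < length (butlast xs) \<and> butlast xs ! i \<in> nbrs X (last xs)}
      = card (nbrs X (last xs))"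
    using d by (intro card_nth_indices) (auto simp: distinct_butlast)
  moreover have "{i. i < length (butlast xs) \<and> butlast xs ! i \<in> nbrs X (last xs)} = J"
    by (auto simp: J_def nth_butlast)
  ultimately have cJ: "card J = card (nbrs X (last xs))" by simp
  \<comment> \<open>Pigeonhole: both sets lie among \<open>length xs - 1\<close> indices, while
    their sizes add up to at least \<open>length xs\<close>.\<close>
  have "I \<inter> J \<noteq> {}"
  proof
    assume "I \<inter> J = {}"
    then have "card (I \<union> J) = card I + card J"
      by (intro card_Un_disjoint) (auto simp: I_def J_def)
    moreover have "card (I \<union> J) \<le> card {..<?k}" by (intro card_mono) (auto simp: I_def J_def)
    ultimately show False using deg cI cJ ne by (cases xs) auto
  qed
  then obtain i where i: "i < ?k" "xs ! Suc i \<in> nbrs X (hd xs)" "xs ! i \<in> nbrs X (last xs)"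
    by (auto simp: I_def J_def)
  define P Q where "P = take (Suc i) xs" and "Q = drop (Suc i) xs"
  have PQ: "xs = P @ Q" "P \<noteq> []" "Q \<noteq> []" using i by (auto simp: P_def Q_def)
  have h: "hd Q = xs ! Suc i" using i by (simp add: Q_def hd_drop_conv_nth)
  have l: "last P = xs ! i" using i by (simp add: P_def take_Suc_conv_app_nth)
  have e: "hd Q \<in> nbrs X (hd P)" "last P \<in> nbrs X (last Q)" using i h l PQ by auto
  \<comment> \<open>Run through \<open>P\<close>, jump from its end to the end of \<open>Q\<close>,
    and return through \<open>Q\<close> to \<open>hd Q\<close>, which is joined to
    \<open>hd P\<close>.\<close>
  show thesis
  proof
    show "path_in X (P @ rev Q)"
      using path e PQ(2,3) unfolding PQ(1) path_in_def
      by (auto simp: path_edges_append path_edges_rev hd_rev nbrs_def insert_commute)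
    show "set (P @ rev Q) = set xs" "P @ rev Q \<noteq> []" using PQ by auto
    show "last (P @ rev Q) \<in> nbrs X (hd (P @ rev Q))"
      using PQ(2,3) e by (simp add: last_rev)
  qed
qed

text \<open>A longest path has all neighbours of its ends on it. If it missed a vertex
  \<open>w\<close>, it would close to a cycle on the same vertices; \<open>w\<close> is joined to
  this cycle, and cutting the cycle there gives a longer path.\<close>

lemma ex_hamiltonian_path:
  assumes X: "simple_graph X" and deg: "\<forall>v \<in> verts X. card (verts X) \<le> 2 * degree X v + 1"
  obtains xs where "path_in X xs" "set xs = verts X"
proof -
  have fin: "finite (verts X)" using X by (simp add: simple_graph_def)
  obtain v where v: "v \<in> verts X" using X by (auto simp: simple_graph_def)
  have bound: "length xs \<le> card (verts X)" if "path_in X xs" for xs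
    using that fin unfolding path_in_def by (metis card_mono distinct_card)
  have "path_in X [v]" using v by (simp add: path_in_def)
  then obtain xs where xs: "path_in X xs" "\<And>ys. path_in X ys \<Longrightarrow> length ys \<le> length xs"
    using ex_has_greatest_nat[of "path_in X" "[v]" length "Suc (card (verts X))"] bound
    by (metis le_imp_less_Suc)
  have ne: "xs \<noteq> []" using xs(2)[OF \<open>path_in X [v]\<close>] by auto
  have "set xs = verts X"
  proof (rule ccontr)
    assume "set xs \<noteq> verts X"
    then obtain w where w: "w \<in> verts X" "w \<notin> set xs" using xs(1) by (auto simp: path_in_def)
    have max_hd: "nbrs X (hd ys) \<subseteq> set ys"
      if "path_in X ys" "length ys = length xs" for ys
    proof
      fix u assume u: "u \<in> nbrs X (hd ys)"
      show "u \<in> set ys"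
      proof (rule ccontr)
        assume "u \<notin> set ys"
        then have "path_in X (u # ys)"
          using that u nbrs_subset[OF X, of "hd ys"]
          by (auto simp: path_in_def path_edges_Cons nbrs_def insert_commute)
        then show False using xs(2) that(2) by fastforce
      qed
    qed
    have ends: "hd xs \<in> set xs" "last xs \<in> set xs" "set xs \<subseteq> verts X"
      using ne xs(1) by (auto simp: path_in_def)
    have hd: "nbrs X (hd xs) \<subseteq> set xs" using max_hd xs(1) by simp
    have last: "nbrs X (last xs) \<subseteq> set xs"
      using max_hd[of "rev xs"] xs(1) by (simp add: path_in_rev hd_rev)
    have len: "card (set xs) = length xs" using xs(1) by (simp add: path_in_def distinct_card)
    have "set xs \<subset> verts X" using w ends by auto
    then have lt: "length xs < card (verts X)" using psubset_card_mono[OF fin] len by metis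
    have degs: "card (verts X) \<le> 2 * card (nbrs X u) + 1" if "u \<in> verts X" for u
      using deg that by (simp add: degree_eq_card_nbrs[OF X])
    \<comment> \<open>The two degrees add up to at least \<open>card (verts X) - 1\<close>, and this
      is at least \<open>length xs\<close> because \<open>w\<close> is missed.\<close>
    have "length xs \<le> card (nbrs X (hd xs)) + card (nbrs X (last xs))"
      using degs[of "hd xs"] degs[of "last xs"] subsetD[OF ends(3)] ends(1,2) lt by fastforce
    then obtain cs where cs: "path_in X cs" "set cs = set xs" "cs \<noteq> []" "last cs \<in> nbrs X (hd cs)"
      using path_to_cycle[OF X xs(1) ne hd last] by blast
    \<comment> \<open>Otherwise, with \<open>N = card (verts X)\<close> and
      \<open>k = length xs\<close>, the degrees of \<open>w\<close> and \<open>hd xs\<close> are at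
      most \<open>N - k - 1\<close> and \<open>k - 1\<close>. Their sum \<open>N - 2\<close> is less
      than the required \<open>N - 1\<close>.\<close>
    have "nbrs X w \<inter> set cs \<noteq> {}"
    proof
      assume "nbrs X w \<inter> set cs = {}"
      then have "nbrs X w \<subseteq> verts X - set xs - {w}" using nbrs_subset[OF X, of w] cs(2) by auto
      then have "card (nbrs X w) \<le> card (verts X - set xs - {w})" using fin by (intro card_mono) auto
      also have "\<dots> = card (verts X) - length xs - 1"
        using w fin ends len by (simp add: card_Diff_subset)
      finally have 1: "card (nbrs X w) \<le> card (verts X) - length xs - 1" .
      have "nbrs X (hd xs) \<subseteq> set xs - {hd xs}" using hd nbrs_subset[OF X, of "hd xs"] by auto
      then have "card (nbrs X (hd xs)) \<le> card (set xs - {hd xs})" by (intro card_mono) auto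
      also have "\<dots> = length xs - 1" using ends len by simp
      finally have 2: "card (nbrs X (hd xs)) \<le> length xs - 1" .
      show False using 1 2 degs[of w] degs[of "hd xs"] w ends lt ne by (cases xs) auto
    qed
    then obtain x where x: "x \<in> nbrs X w" "x \<in> set cs" by auto
    then obtain as bs where ab: "cs = as @ x # bs" by (meson split_list)
    \<comment> \<open>The cycle is cut just before \<open>x\<close>; its closing edge joins the end
      of \<open>x # bs\<close> to the start of \<open>as\<close>.\<close>
    have "path_in X (w # x # bs @ as)"
      using cs x w unfolding ab path_in_def
      by (auto simp: path_edges_append path_edges_Cons nbrs_def insert_commute split: if_splits)
    moreover have "length cs = length xs"
      using cs len by (metis distinct_card path_in_def)
    ultimately show False using xs(2) ab by fastforce
  qed
  then show thesis using that xs(1) by blast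
qed

section \<open>From a Hamiltonian path to a spanning spider\<close>

abbreviation has_spanning_spider :: "'a ugraph \<Rightarrow> bool" where
  "has_spanning_spider X \<equiv> \<exists>c A B C. spanning_spider X c A B C"

text \<open>Replacing the first edge of the path by the chord makes \<open>z\<close> a centre with
  legs \<open>[x]\<close>, \<open>rev P\<close> and \<open>Q\<close>.\<close>

lemma spider_of_end_chord:
  assumes "path_in X (x # P @ z # Q)" "set (x # P @ z # Q) = verts X" "z \<in> nbrs X x"
    and "length P \<ge> 2" "length Q \<ge> 2" "length P \<noteq> length Q"
  shows "has_spanning_spider X"
proof -
  have "spider z [x] (rev P) Q \<subseteq> edges X"
    using assms(1,3,4,5) path_edges_rev[of "P @ [z]"]
    by (auto simp: spider_def path_in_def path_edges_Cons path_edges_append nbrs_def insert_commute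
        split: if_splits)
  \<comment> \<open>Either of the two long legs may be the longer one, so both orders are
    offered.\<close>
  then have "spanning_spider X z [x] (rev P) Q \<or> spanning_spider X z [x] Q (rev P)"
    using assms unfolding spanning_spider_def path_in_def by (auto simp: spider_commute)
  then show ?thesis by blast
qed

text \<open>Here the path closes to a cycle. Adding the chord from \<open>a\<close> to
  \<open>c\<close> and deleting the edges from \<open>b\<close> to \<open>c\<close> and from
  \<open>d\<close> to \<open>hd Q\<close> leaves legs of lengths 1, 2 and at least 3 at
  \<open>a\<close>.\<close>

lemma spider_of_short_chord:
  assumes "path_in X (a # b # c # d # Q)" "set (a # b # c # d # Q) = verts X"
    and "c \<in> nbrs X a" "last Q \<in> nbrs X a" "length Q \<ge> 3"
  shows "has_spanning_spider X"
proof -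
  have "spider a [b] [c, d] (rev Q) \<subseteq> edges X"
    using assms(1,3,4,5)
    by (auto simp: spider_def path_in_def path_edges_Cons path_edges_rev hd_rev nbrs_def insert_commute
        split: if_splits)
  then have "spanning_spider X a [b] [c, d] (rev Q)"
    using assms unfolding spanning_spider_def path_in_def by auto
  then show ?thesis by blast
qed

text \<open>The chord leaves \<open>j\<close> vertices of \<open>ys\<close> before its end and
  \<open>length ys - j - 1\<close> after it; the numerical conditions say that both numbers are at
  least 2 and that they differ.\<close>

lemma spider_of_chord_index:
  assumes "path_in X (x # ys)" "set (x # ys) = verts X" "ys ! j \<in> nbrs X x"
    and "2 \<le> j" "j + 3 \<le> length ys" "2 * j + 1 \<noteq> length ys"
  shows "has_spanning_spider X"
proof -
  have ys: "ys = take j ys @ ys ! j # drop (Suc j) ys"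
    using assms(5) by (intro id_take_nth_drop) simp
  show ?thesis
    by (rule spider_of_end_chord[of X x "take j ys" "ys ! j" "drop (Suc j) ys"])
      (use assms in \<open>auto simp flip: ys\<close>)
qed

text \<open>Parity decides. For odd \<open>l\<close>, at least 7, the set has at least 4 elements
  but only 3 candidates; for even \<open>l\<close> the middle index does not exist, and at least 3
  elements face 2 candidates.\<close>

lemma three_exceptions:
  fixes J :: "nat set"
  assumes "6 \<le> l" "l \<le> 2 * card J" and J: "\<And>j. j \<in> J \<Longrightarrow> j = a \<or> j = b \<or> 2 * j + 1 = l"
  shows False
proof (cases "odd l")
  case True
  have "J \<subseteq> {a, b, (l - 1) div 2}" using J by fastforce
  then have "card J \<le> card {a, b, (l - 1) div 2}" by (intro card_mono) auto
  moreover have "card {a, b, (l - 1) div 2} \<le> 3" by (simp add: card_insert_if)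
  moreover have "card J \<ge> 4" using assms(1,2) True by presburger
  ultimately show False by simp
next
  case False
  then have "J \<subseteq> {a, b}" using J by force
  then have "card J \<le> card {a, b}" by (intro card_mono) auto
  moreover have "card {a, b} \<le> 2" by (simp add: card_insert_if)
  ultimately show False using assms(1,2) by simp
qed

context
  fixes X :: "'a ugraph"
  assumes X: "simple_graph X" and big: "card (verts X) \<ge> 7"
    and deg: "\<forall>v \<in> verts X. card (verts X) \<le> 2 * degree X v + 1"
begin

text \<open>Supplies the two numerical premises of \<open>three_exceptions\<close>: all neighbours
  of \<open>x\<close> lie on \<open>ys\<close>, whose length is the order minus one.\<close>

lemma card_neighbour_indices:
  assumes "path_in X (x # ys)" "set (x # ys) = verts X"
  shows "6 \<le> length ys" "length ys \<le> 2 * card {j. j < length ys \<and> ys ! j \<in> nbrs X x}"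
proof -
  have d: "distinct (x # ys)" using assms(1) by (simp add: path_in_def)
  then have l: "card (verts X) = Suc (length ys)"
    using distinct_card[OF d] unfolding assms(2) by simp
  then show "6 \<le> length ys" using big by simp
  have "nbrs X x \<subseteq> set ys" using nbrs_subset[OF X, of x] assms(2) by auto
  then have "card {j. j < length ys \<and> ys ! j \<in> nbrs X x} = card (nbrs X x)"
    using d by (intro card_nth_indices) auto
  moreover have "x \<in> verts X" using assms(2) by auto
  ultimately show "length ys \<le> 2 * card {j. j < length ys \<and> ys ! j \<in> nbrs X x}"
    using deg l by (simp add: degree_eq_card_nbrs[OF X])
qed

lemma spider_of_cycle_short_chord:
  assumes "path_in X (x # ys)" "set (x # ys) = verts X" "last ys \<in> nbrs X x" "ys ! 1 \<in> nbrs X x"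
  shows "has_spanning_spider X"
proof -
  have "6 \<le> length ys" using card_neighbour_indices assms by blast
  then obtain b c d Q where ys: "ys = b # c # d # Q" "length Q \<ge> 3"
    by (auto simp: numeral_eq_Suc Suc_le_length_iff)
  then have "Q \<noteq> []" by auto
  then show ?thesis using assms ys by (intro spider_of_short_chord[of X x b c d Q]) auto
qed

lemma spider_of_cycle:
  assumes p: "path_in X (x # ys)" "set (x # ys) = verts X" "last ys \<in> nbrs X x"
  shows "has_spanning_spider X"
proof (rule ccontr)
  assume no: "\<not> has_spanning_spider X"
  let ?l = "length ys"
  note l = card_neighbour_indices[OF p(1,2)]
  show False
  proof (rule three_exceptions[OF l])
    fix j assume j: "j \<in> {j. j < length ys \<and> ys ! j \<in> nbrs X x}"
    have "j \<noteq> 1" using spider_of_cycle_short_chord[OF p] no j by auto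
    moreover have "j \<noteq> ?l - 2"
    proof
      assume "j = ?l - 2"
      have ne: "ys \<noteq> []" using l(1) by auto
      have "{x, last ys} \<in> edges X" using p(3) by (simp add: nbrs_def)
      \<comment> \<open>Traversing the cycle backwards from \<open>x\<close> turns position
        \<open>?l - 2\<close> into position 1.\<close>
      then have "path_in X (x # rev ys)"
        using p(1) ne by (auto simp: path_in_def path_edges_Cons path_edges_rev hd_rev)
      moreover have "last (rev ys) \<in> nbrs X x"
        using p(1) ne by (simp add: last_rev path_in_def path_edges_Cons nbrs_def)
      moreover have "rev ys ! 1 \<in> nbrs X x"
        using j \<open>j = ?l - 2\<close> l(1) by (simp add: rev_nth numeral_2_eq_2)
      ultimately show False
        using spider_of_cycle_short_chord[of x "rev ys"] p(2) no by simp
    qed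
    moreover have "\<not> (2 \<le> j \<and> j + 3 \<le> ?l \<and> 2 * j + 1 \<noteq> ?l)"
      using spider_of_chord_index[OF p(1,2)] no j by auto
    ultimately show "j = 0 \<or> j = ?l - 1 \<or> 2 * j + 1 = ?l" using j by auto
  qed
qed

text \<open>Without a spanning spider the path does not close to a cycle, so the neighbours of
  \<open>x\<close> occupy only positions 0, 1, \<open>length ys - 2\<close> or the middle. Losing
  position 1 or \<open>length ys - 2\<close> would leave too few.\<close>

lemma chords_of_extremal_path:
  assumes p: "path_in X (x # ys)" "set (x # ys) = verts X" and no: "\<not> has_spanning_spider X"
  shows "ys ! 1 \<in> nbrs X x" "ys ! (length ys - 2) \<in> nbrs X x"
proof -
  let ?l = "length ys"
  note l = card_neighbour_indices[OF p]
  have ne: "ys \<noteq> []" using l(1) by auto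
  have A: "j \<in> {0, 1, ?l - 2} \<or> 2 * j + 1 = ?l"
    if j: "j \<in> {j. j < ?l \<and> ys ! j \<in> nbrs X x}" for j
  proof -
    have "j \<noteq> ?l - 1" using spider_of_cycle[OF p] no j ne by (auto simp: last_conv_nth)
    moreover have "\<not> (2 \<le> j \<and> j + 3 \<le> ?l \<and> 2 * j + 1 \<noteq> ?l)"
      using spider_of_chord_index[OF p] no j by auto
    ultimately show ?thesis using j by auto
  qed
  show "ys ! 1 \<in> nbrs X x"
  proof (rule ccontr)
    assume "ys ! 1 \<notin> nbrs X x"
    then show False using A by (intro three_exceptions[OF l, of 0 "?l - 2"]) auto
  qed
  show "ys ! (?l - 2) \<in> nbrs X x"
  proof (rule ccontr)
    assume "ys ! (?l - 2) \<notin> nbrs X x"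
    then show False using A by (intro three_exceptions[OF l, of 0 1]) auto
  qed
qed

lemma ex_spanning_spider: "has_spanning_spider X"
proof (rule ccontr)
  assume no: "\<not> has_spanning_spider X"
  obtain xs where xs: "path_in X xs" "set xs = verts X" by (rule ex_hamiltonian_path[OF X deg])
  obtain x ys where x: "xs = x # ys" using xs(2) big by (cases xs) auto
  have l: "6 \<le> length ys" using card_neighbour_indices xs x by blast
  then obtain b c R where "ys = b # c # R" "R \<noteq> []"
    by (auto simp: numeral_eq_Suc Suc_le_length_iff)
  moreover obtain Q z where "R = Q @ [z]" using \<open>R \<noteq> []\<close> by (cases R rule: rev_cases) auto
  ultimately have ys: "ys = b # c # Q @ [z]" by simp
  have c: "c \<in> nbrs X x" using chords_of_extremal_path(1)[of x ys] xs x no ys by simp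
  \<comment> \<open>Read from the other end, the path finishes with \<open>b\<close> and then
    \<open>x\<close>, so \<open>b\<close> stands at the second position from the end.\<close>
  have "path_in X (z # rev (x # b # c # Q))" "set (z # rev (x # b # c # Q)) = verts X"
    using xs path_in_rev[of X xs] by (auto simp: x ys)
  then have b: "b \<in> nbrs X z"
    using chords_of_extremal_path(2)[of z "rev (x # b # c # Q)"] no by (simp add: nth_append)
  \<comment> \<open>Only the edge from \<open>b\<close> to \<open>c\<close> is given up: the two
    chords come in, and the old edge from \<open>x\<close> to \<open>b\<close> closes the
    cycle.\<close>
  have "path_in X (x # c # Q @ [z, b])"
    using xs(1) b c unfolding x ys
    by (auto simp: path_in_def path_edges_Cons path_edges_append nbrs_def split: if_splits)
  moreover have "last (c # Q @ [z, b]) \<in> nbrs X x"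
    using xs(1) unfolding x ys by (auto simp: path_in_def nbrs_def)
  moreover have "set (x # c # Q @ [z, b]) = verts X" using xs(2) unfolding x ys by auto
  ultimately show False using spider_of_cycle no by blast
qed

end

section \<open>Joins\<close>

lemma simple_graph_join:
  assumes "simple_graph G" "simple_graph H" "verts G \<inter> verts H = {}"
  shows "simple_graph (join G H)"
proof -
  have "card {u, v} = 2" if "u \<in> verts G" "v \<in> verts H" for u v
    using that assms(3) by (metis card_2_iff disjoint_iff)
  then show ?thesis using assms(1,2) unfolding simple_graph_def join_def by auto
qed

lemma join_commute: "join G H = join H G"
  by (auto simp: join_def insert_commute)

text \<open>A vertex of \<open>G\<close> keeps its neighbours in \<open>G\<close> and gains all of
  \<open>H\<close>, and these two sets are disjoint.\<close>

lemma min_degree_join: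
  assumes "simple_graph G" "simple_graph H" "verts G \<inter> verts H = {}" "v \<in> verts G"
  shows "min_degree G + card (verts H) \<le> degree (join G H) v"
proof -
  have sub: "nbrs G v \<union> verts H \<subseteq> nbrs (join G H) v"
    using assms(4) by (auto simp: nbrs_def join_def)
  have disj: "nbrs G v \<inter> verts H = {}" using nbrs_subset[OF assms(1), of v] assms(3) by auto
  have "min_degree G \<le> degree G v"
    using assms(1,4) unfolding min_degree_def simple_graph_def by (intro Min_le) auto
  then have "min_degree G + card (verts H) \<le> card (nbrs G v) + card (verts H)"
    by (simp add: degree_eq_card_nbrs[OF assms(1)])
  also have "\<dots> = card (nbrs G v \<union> verts H)"
    using disj finite_nbrs[OF assms(1)] assms(2) by (simp add: card_Un_disjoint simple_graph_def)
  also have "\<dots> \<le> card (nbrs (join G H) v)"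
    using sub finite_nbrs[OF simple_graph_join[OF assms(1-3)]] by (intro card_mono)
  finally show ?thesis by (simp add: degree_eq_card_nbrs[OF simple_graph_join[OF assms(1-3)]])
qed

theorem theorem3p5:
  fixes G H :: "'a ugraph" and n m :: nat
  assumes "simple_graph G" and "simple_graph H"
    and "verts G \<inter> verts H = {}"
    and "card (verts G) = n" and "card (verts H) = m"
    and "min_degree G \<le> min_degree H"
    and "real (min (min_degree G + m) (min_degree H + n)) \<ge> (real n + real m - 1) / 2"
    and "m + n \<ge> 7"
  shows "distinguishing_index (join G H) \<le> 2"
proof -
  have V: "verts (join G H) = verts G \<union> verts H" by (simp add: join_def)
  then have card: "card (verts (join G H)) = n + m"
    using assms(1-5) by (simp add: card_Un_disjoint simple_graph_def)
  \<comment> \<open>The bound \<open>(n + m - 1) / 2\<close> is doubled and its \<open>- 1\<close>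
    moved to the other side, which avoids truncated subtraction.\<close>
  have "n + m \<le> 2 * degree (join G H) v + 1" if "v \<in> verts (join G H)" for v
  proof -
    have "min_degree G + m \<le> degree (join G H) v \<or> min_degree H + n \<le> degree (join G H) v"
      using that min_degree_join[of G H v] min_degree_join[of H G v] assms(1-5)
      unfolding V join_commute[of H G] by auto
    then have "min (min_degree G + m) (min_degree H + n) \<le> degree (join G H) v" by linarith
    then have "real (min (min_degree G + m) (min_degree H + n)) \<le> real (degree (join G H) v)"
      by (rule of_nat_mono)
    then have "real n + real m - 1 \<le> 2 * real (degree (join G H) v)" using assms(7) by argo
    then show ?thesis by linarith
  qed
  then have "has_spanning_spider (join G H)"
    using ex_spanning_spider[OF simple_graph_join[OF assms(1-3)]] card assms(8) by simp
  then show ?thesis by (elim exE) (rule spanning_spider_index)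
qed

end
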